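(* Let $R$ be a finite associative ring with unity, and let $i$ be the number of idempotents in $R$. If $R$ is noncommutative, then $i \leq \frac{3|R|}{4}$. Further, if $R$ is noncommutative and $i = \frac{3|R|}{4}$, then $R$ is generated as a ring by a Boolean ring $C$ contained in the center of $R$ and two noncommuting idempotents $b, c$, such that $|C| = \frac{|R|}{4}$.
   Context: An idempotent is an element $x$ with $x^2 = x$. A ring is Boolean if each of its elements is an idempotent. All rings are associative with unity. *)

theory Defs
  imports Complex_Main "HOL-Algebra.Generated_Rings"
begin

definition ring_idempotents :: "('a, 'm) ring_scheme \<Rightarrow> 'a set"
  where "ring_idempotents R = {x \<in> carrier R. x \<otimes>\<^bsub>R\<^esub> x = x}"

definition ring_center :: "('a, 'm) ring_scheme \<Rightarrow> 'a set"
  where "ring_center R =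
    {z \<in> carrier R. \<forall>x \<in> carrier R. z \<otimes>\<^bsub>R\<^esub> x = x \<otimes>\<^bsub>R\<^esub> z}"

locale boolean_ring = ring +
  assumes boolean: "carrier R \<subseteq> ring_idempotents R"

end

theory Submission
  imports Defs
begin

text \<open>
  The whole argument counts pairs of idempotents with a prescribed difference. If the set \<open>I\<close> of
  idempotents has at least \<open>3|R|/4\<close> elements, then for each \<open>x\<close> the sets \<open>I\<close> and \<open>I - x\<close> overlap in
  at least \<open>|R|/2\<close> elements \<open>e\<close>. Expanding \<open>(e + x)\<^sup>2 = e + x\<close> shows that such an \<open>e\<close> solves the
  equation \<open>e x + x e = x - x\<^sup>2\<close>, which is linear in \<open>e\<close>; hence the subgroup of solutions of the
  homogeneous equation \<open>e x + x e = 0\<close> has index at most two.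

  Taking \<open>x = 1\<close> and \<open>x = 2\<close> forces characteristic two, so the homogeneous solutions form the
  centralizer of \<open>x\<close>, and all centralizers have index at most two. If \<open>|I| > 3|R|/4\<close> the index is
  always one and \<open>R\<close> is commutative, which proves the inequality.

  In the case of equality, let \<open>x\<close> be a noncentral idempotent. Its centralizer has exactly \<open>|R|/2\<close>
  elements and contains all the \<open>e\<close> counted above, so it consists of idempotents and is therefore
  commutative. Because more than half of the elements are idempotents, there are idempotents \<open>b\<close>
  and \<open>c\<close> that do not commute. Both centralizers have index two, and since that of \<open>b\<close> is
  commutative and together with \<open>c\<close> generates \<open>R\<close>, their intersection is the center. Thus the
  center is Boolean of index four, with coset representatives \<open>0, b, c, b + c\<close>.
\<close>

section \<open>Translates in finite abelian groups\<close>

lemma (in abelian_group) card_subgroup_Un_translate: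
  assumes fin: "finite (carrier G)" and H: "additive_subgroup H G"
    and y: "y \<in> carrier G" "y \<notin> H"
  shows "card (H \<union> (\<lambda>h. y \<oplus> h) ` H) = 2 * card H"
proof -
  interpret additive_subgroup H G by (rule H)
  have sub: "H \<subseteq> carrier G" by (rule a_subset)
  have "finite H" using fin sub by (rule finite_subset[rotated])
  moreover have "card ((\<lambda>h. y \<oplus> h) ` H) = card H"
    by (rule card_image) (use sub y in \<open>auto simp: inj_on_def\<close>)
  moreover have "H \<inter> (\<lambda>h. y \<oplus> h) ` H = {}"
  proof (rule ccontr)
    assume "H \<inter> (\<lambda>h. y \<oplus> h) ` H \<noteq> {}"
    then obtain h where h: "h \<in> H" "y \<oplus> h \<in> H" by auto
    then have "(y \<oplus> h) \<oplus> \<ominus> h \<in> H" by (simp add: a_inv_closed)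
    moreover have "(y \<oplus> h) \<oplus> \<ominus> h = y"
      using h(1) sub y by (simp add: a_assoc r_neg subsetD)
    ultimately show False using y by simp
  qed
  ultimately show ?thesis by (simp add: card_Un_disjoint)
qed

lemma (in abelian_group) half_subgroup_Un_translate:
  assumes fin: "finite (carrier G)" and H: "additive_subgroup H G"
    and half: "card (carrier G) \<le> 2 * card H"
    and y: "y \<in> carrier G" "y \<notin> H"
  shows "carrier G = H \<union> (\<lambda>h. y \<oplus> h) ` H" and "card (carrier G) = 2 * card H"
proof -
  interpret additive_subgroup H G by (rule H)
  have sub: "H \<union> (\<lambda>h. y \<oplus> h) ` H \<subseteq> carrier G" using a_subset y by auto
  note c = card_subgroup_Un_translate[OF fin H y]
  show eq: "carrier G = H \<union> (\<lambda>h. y \<oplus> h) ` H"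
    using card_seteq[OF fin sub] half c by simp
  show "card (carrier G) = 2 * card H" using c eq by simp
qed

lemma (in abelian_group) card_translate_overlap:
  assumes fin: "finite (carrier G)" and S: "S \<subseteq> carrier G" and x: "x \<in> carrier G"
  shows "2 * card S \<le> card (carrier G) + card {e \<in> S. e \<oplus> x \<in> S}"
proof -
  let ?T = "(\<lambda>s. s \<oplus> \<ominus> x) ` S"
  have finS: "finite S" using S fin by (rule finite_subset)
  have cT: "card ?T = card S"
    using S x by (intro card_image inj_onI) (simp add: subset_iff)
  have "s \<oplus> \<ominus> x \<oplus> x = s" if "s \<in> S" for s
    using that S x by (simp add: a_assoc l_neg subsetD)
  then have "S \<inter> ?T \<subseteq> {e \<in> S. e \<oplus> x \<in> S}" by auto
  then have "card (S \<inter> ?T) \<le> card {e \<in> S. e \<oplus> x \<in> S}"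
    using finS by (intro card_mono) auto
  moreover have "card (S \<union> ?T) \<le> card (carrier G)"
    using S x by (intro card_mono fin) auto
  moreover have "card S + card ?T = card (S \<union> ?T) + card (S \<inter> ?T)"
    using finS by (intro card_Un_Int) auto
  ultimately show ?thesis using cT by linarith
qed

section \<open>Idempotents with a prescribed difference\<close>

text \<open>
  In characteristic two this is the centralizer of \<open>x\<close>; the additive form is what the count of
  idempotents controls before the characteristic is known.
\<close>

definition anticentralizer :: "('a, 'm) ring_scheme \<Rightarrow> 'a \<Rightarrow> 'a set"
  where "anticentralizer R x =
    {e \<in> carrier R. e \<otimes>\<^bsub>R\<^esub> x \<oplus>\<^bsub>R\<^esub> x \<otimes>\<^bsub>R\<^esub> e = \<zero>\<^bsub>R\<^esub>}"

context ring
begin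

lemma additive_subgroup_anticentralizer:
  assumes x: "x \<in> carrier R"
  shows "additive_subgroup (anticentralizer R x) R"
proof (intro additive_subgroup.intro add.subgroupI)
  show "anticentralizer R x \<subseteq> carrier R" by (auto simp: anticentralizer_def)
  show "anticentralizer R x \<noteq> {}"
    using x by (auto simp: anticentralizer_def intro!: exI[of _ \<zero>])
next
  fix a assume "a \<in> anticentralizer R x"
  then show "\<ominus> a \<in> anticentralizer R x"
    using x by (simp add: anticentralizer_def l_minus r_minus minus_add[symmetric])
next
  fix a b assume "a \<in> anticentralizer R x" "b \<in> anticentralizer R x"
  then have a: "a \<in> carrier R" "a \<otimes> x \<oplus> x \<otimes> a = \<zero>"
    and b: "b \<in> carrier R" "b \<otimes> x \<oplus> x \<otimes> b = \<zero>"
    by (auto simp: anticentralizer_def)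
  have "(a \<oplus> b) \<otimes> x \<oplus> x \<otimes> (a \<oplus> b) = (a \<otimes> x \<oplus> x \<otimes> a) \<oplus> (b \<otimes> x \<oplus> x \<otimes> b)"
    using a(1) b(1) x by (simp add: l_distr r_distr a_ac)
  then show "a \<oplus> b \<in> anticentralizer R x"
    using a b by (simp add: anticentralizer_def)
qed

text \<open>The nonempty fibres of the additive map \<open>e \<mapsto> e x + x e\<close> are cosets of its kernel.\<close>

lemma card_anticommutator_fibre_le:
  assumes fin: "finite (carrier R)" and x: "x \<in> carrier R"
  shows "card {e \<in> carrier R. e \<otimes> x \<oplus> x \<otimes> e = v} \<le> card (anticentralizer R x)"
    (is "card ?F \<le> _")
proof (cases "?F = {}")
  case False
  then obtain d where d: "d \<in> carrier R" "d \<otimes> x \<oplus> x \<otimes> d = v" by auto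
  have "(e \<oplus> \<ominus> d) \<otimes> x \<oplus> x \<otimes> (e \<oplus> \<ominus> d) = \<zero>"
    if e: "e \<in> carrier R" "e \<otimes> x \<oplus> x \<otimes> e = v" for e
  proof -
    have "(e \<oplus> \<ominus> d) \<otimes> x \<oplus> x \<otimes> (e \<oplus> \<ominus> d) = (e \<otimes> x \<oplus> x \<otimes> e) \<oplus> \<ominus> (d \<otimes> x \<oplus> x \<otimes> d)"
      using e(1) d(1) x by (simp add: l_distr r_distr l_minus r_minus minus_add a_ac)
    then show ?thesis using e d x by (auto simp: r_neg)
  qed
  then have "(\<lambda>e. e \<oplus> \<ominus> d) ` ?F \<subseteq> anticentralizer R x"
    using d by (auto simp: anticentralizer_def)
  moreover have "finite (anticentralizer R x)" using fin by (simp add: anticentralizer_def)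
  moreover have "inj_on (\<lambda>e. e \<oplus> \<ominus> d) ?F" using d by (auto simp: inj_on_def)
  ultimately show ?thesis by (rule card_inj_on_le[rotated])
qed (metis card.empty le0)

lemma idempotent_translate:
  assumes "x \<in> carrier R" and "e \<in> ring_idempotents R" and "e \<oplus> x \<in> ring_idempotents R"
  shows "e \<otimes> x \<oplus> x \<otimes> e \<oplus> x \<otimes> x = x"
proof -
  have e: "e \<in> carrier R" "e \<otimes> e = e" and ex: "(e \<oplus> x) \<otimes> (e \<oplus> x) = e \<oplus> x"
    using assms by (auto simp: ring_idempotents_def)
  have "e \<oplus> (e \<otimes> x \<oplus> x \<otimes> e \<oplus> x \<otimes> x) = e \<otimes> e \<oplus> (e \<otimes> x \<oplus> x \<otimes> e \<oplus> x \<otimes> x)"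
    using e by simp
  also have "\<dots> = (e \<oplus> x) \<otimes> (e \<oplus> x)"
    using e(1) assms(1) by (simp only: l_distr r_distr a_ac m_closed a_closed)
  finally have "(e \<otimes> x \<oplus> x \<otimes> e \<oplus> x \<otimes> x) \<oplus> e = x \<oplus> e"
    using ex e(1) assms(1) by (simp only: a_comm m_closed a_closed)
  then show ?thesis using e(1) assms(1) by (simp only: add.right_cancel m_closed a_closed)
qed

lemma idempotent_translates_in_fibre:
  assumes x: "x \<in> carrier R"
  shows "{e \<in> ring_idempotents R. e \<oplus> x \<in> ring_idempotents R}
    \<subseteq> {e \<in> carrier R. e \<otimes> x \<oplus> x \<otimes> e = x \<ominus> x \<otimes> x}"
proof (intro subsetI CollectI conjI)
  fix e assume "e \<in> {e \<in> ring_idempotents R. e \<oplus> x \<in> ring_idempotents R}"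
  then have e: "e \<in> ring_idempotents R" "e \<oplus> x \<in> ring_idempotents R" by auto
  show ec: "e \<in> carrier R" using e by (auto simp: ring_idempotents_def)
  have "e \<otimes> x \<oplus> x \<otimes> e = (e \<otimes> x \<oplus> x \<otimes> e \<oplus> x \<otimes> x) \<ominus> x \<otimes> x"
    using ec x by (simp add: minus_eq a_assoc r_neg)
  then show "e \<otimes> x \<oplus> x \<otimes> e = x \<ominus> x \<otimes> x"
    using idempotent_translate[OF x e] by simp
qed

lemma card_idempotents_le_anticentralizer:
  assumes fin: "finite (carrier R)" and x: "x \<in> carrier R"
  shows "2 * card (ring_idempotents R) \<le> card (carrier R) + card (anticentralizer R x)"
proof -
  have "card {e \<in> ring_idempotents R. e \<oplus> x \<in> ring_idempotents R}
      \<le> card {e \<in> carrier R. e \<otimes> x \<oplus> x \<otimes> e = x \<ominus> x \<otimes> x}"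
    using fin by (intro card_mono idempotent_translates_in_fibre x) auto
  also have "\<dots> \<le> card (anticentralizer R x)"
    by (rule card_anticommutator_fibre_le[OF fin x])
  finally show ?thesis
    using card_translate_overlap[OF fin _ x, of "ring_idempotents R"]
    by (simp add: ring_idempotents_def)
qed

section \<open>Characteristic two\<close>

text \<open>
  The elements of additive order at most two form a subgroup of index at most two, the
  anticentralizer of \<open>1\<close>. Such a subgroup contains \<open>1 + 1\<close>, so \<open>4 = 0\<close>. The count also supplies
  an idempotent \<open>e\<close> with \<open>e + 2\<close> idempotent; expanding the square yields \<open>4e + 4 = 2\<close>, hence \<open>2 = 0\<close>.
\<close>

lemma char_two_if_many_idempotents:
  assumes fin: "finite (carrier R)"
    and many: "3 * card (carrier R) \<le> 4 * card (ring_idempotents R)"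
  shows "\<one> \<oplus> \<one> = \<zero>"
proof (rule ccontr)
  let ?t = "\<one> \<oplus> \<one>" and ?K = "anticentralizer R \<one>"
  assume ne: "?t \<noteq> \<zero>"
  note K = additive_subgroup_anticentralizer[OF one_closed]
  have one: "\<one> \<notin> ?K" using ne by (simp add: anticentralizer_def)
  have half: "card (carrier R) \<le> 2 * card ?K"
    using card_idempotents_le_anticentralizer[OF fin one_closed] many by linarith
  have "?t \<in> carrier R" by simp
  then have "?t \<in> ?K \<union> (\<lambda>h. \<one> \<oplus> h) ` ?K"
    using half_subgroup_Un_translate(1)[OF fin K half one_closed one]
    by blast
  moreover have "h = \<one>" if "h \<in> ?K" "?t = \<one> \<oplus> h" for h
  proof -
    have h: "h \<in> carrier R" using that(1) by (simp add: anticentralizer_def)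
    then have "\<one> \<oplus> \<one> = h \<oplus> \<one>" using that(2) by (simp only: a_comm one_closed)
    then show ?thesis using h by (simp only: add.right_cancel one_closed)
  qed
  ultimately have "?t \<in> ?K" using one by blast
  then have four: "?t \<oplus> ?t = \<zero>" by (simp add: anticentralizer_def)
  have "0 < card (carrier R)" using fin one_closed by (auto simp: card_gt_0_iff)
  then have "0 < card {e \<in> ring_idempotents R. e \<oplus> ?t \<in> ring_idempotents R}"
    using card_translate_overlap[OF fin _ \<open>?t \<in> carrier R\<close>, of "ring_idempotents R"] many
    by (simp add: ring_idempotents_def)
  then obtain e where e: "e \<in> ring_idempotents R" "e \<oplus> ?t \<in> ring_idempotents R"
    by (auto simp: card_gt_0_iff)
  then have ec: "e \<in> carrier R" by (simp add: ring_idempotents_def)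
  have "?t \<otimes> ?t = ?t \<oplus> ?t" by (simp only: l_distr l_one one_closed a_closed)
  then have tt: "?t \<otimes> ?t = \<zero>" using four by (simp only:)
  have "e \<otimes> ?t \<oplus> ?t \<otimes> e = e \<otimes> (?t \<oplus> ?t)"
    using ec by (simp add: l_distr r_distr)
  then have "e \<otimes> ?t \<oplus> ?t \<otimes> e = \<zero>" using four ec by (simp only: r_null)
  then have "?t = \<zero>" using idempotent_translate[OF \<open>?t \<in> carrier R\<close> e] tt by simp
  then show False using ne by contradiction
qed

lemma add_self_char_two:
  assumes "\<one> \<oplus> \<one> = \<zero>" and x: "x \<in> carrier R"
  shows "x \<oplus> x = \<zero>"
proof -
  have "x \<oplus> x = (\<one> \<oplus> \<one>) \<otimes> x" using x by (simp add: l_distr)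
  then show ?thesis using assms by simp
qed

lemma add_eq_zero_iff_char_two:
  assumes two: "\<one> \<oplus> \<one> = \<zero>" and "x \<in> carrier R" "y \<in> carrier R"
  shows "x \<oplus> y = \<zero> \<longleftrightarrow> x = y"
  using add_self_char_two[OF two assms(3)] add.right_cancel[OF assms(3,2,3)] by simp

lemma mem_anticentralizer_iff_commute:
  assumes two: "\<one> \<oplus> \<one> = \<zero>" and "x \<in> carrier R"
  shows "e \<in> anticentralizer R x \<longleftrightarrow> e \<in> carrier R \<and> e \<otimes> x = x \<otimes> e"
  using assms(2) by (auto simp: anticentralizer_def add_eq_zero_iff_char_two[OF two])

lemma commute_if_card_idempotents_gt:
  assumes fin: "finite (carrier R)"
    and many: "3 * card (carrier R) < 4 * card (ring_idempotents R)"
    and x: "x \<in> carrier R" and y: "y \<in> carrier R"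
  shows "x \<otimes> y = y \<otimes> x"
proof -
  have two: "\<one> \<oplus> \<one> = \<zero>" using char_two_if_many_idempotents[OF fin] many by simp
  have gt: "card (carrier R) < 2 * card (anticentralizer R y)"
    using card_idempotents_le_anticentralizer[OF fin y] many by linarith
  have "x \<in> anticentralizer R y"
    using half_subgroup_Un_translate(2)[OF fin additive_subgroup_anticentralizer[OF y] _ x] gt
    by fastforce
  then show ?thesis using mem_anticentralizer_iff_commute[OF two y] by simp
qed

section \<open>The center and the centralizers of idempotents\<close>

lemma subring_ring_center: "subring (ring_center R) R"
proof (rule subringI)
  fix a b assume ab: "a \<in> ring_center R" "b \<in> ring_center R"
  then have c: "a \<in> carrier R" "b \<in> carrier R" by (auto simp: ring_center_def)
  have ax: "a \<otimes> x = x \<otimes> a" and bx: "b \<otimes> x = x \<otimes> b" if "x \<in> carrier R" for x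
    using ab that by (auto simp: ring_center_def)
  have "(a \<otimes> b) \<otimes> x = x \<otimes> (a \<otimes> b)" if x: "x \<in> carrier R" for x
    using m_assoc[OF c x] m_assoc[OF c(1) x c(2)] m_assoc[OF x c] ax[OF x] bx[OF x] by simp
  then show "a \<otimes> b \<in> ring_center R" using c by (simp add: ring_center_def)
  show "a \<oplus> b \<in> ring_center R"
    using c ax bx by (simp add: ring_center_def l_distr r_distr)
qed (auto simp: ring_center_def l_minus r_minus)

lemma boolean_ring_subring:
  assumes C: "subring C R" and idem: "C \<subseteq> ring_idempotents R"
  shows "boolean_ring (R\<lparr>carrier := C\<rparr>)"
  using subring_is_ring[OF C] idem
  by (auto simp: boolean_ring_def boolean_ring_axioms_def ring_idempotents_def)

text \<open>
  When the centralizer of \<open>b\<close> is proper, it has \<open>|R|/2\<close> elements, no more than the number of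
  idempotents \<open>e\<close> with \<open>e + b\<close> idempotent. All these \<open>e\<close> commute with the idempotent \<open>b\<close>, so they
  exhaust the centralizer.
\<close>

lemma centralizer_noncentral_idempotent:
  assumes fin: "finite (carrier R)"
    and many: "3 * card (carrier R) \<le> 4 * card (ring_idempotents R)"
    and b: "b \<in> ring_idempotents R"
    and y: "y \<in> carrier R" "y \<notin> anticentralizer R b"
  shows "anticentralizer R b \<subseteq> ring_idempotents R"
proof -
  let ?P = "{e \<in> ring_idempotents R. e \<oplus> b \<in> ring_idempotents R}"
  let ?C = "anticentralizer R b"
  have bc: "b \<in> carrier R" and bb: "b \<otimes> b = b" using b by (auto simp: ring_idempotents_def)
  have "b \<ominus> b \<otimes> b = \<zero>" using bb bc by (simp add: minus_eq r_neg)
  then have PC: "?P \<subseteq> ?C"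
    using idempotent_translates_in_fibre[OF bc] by (simp add: anticentralizer_def)
  have half: "card (carrier R) \<le> 2 * card ?C"
    using card_idempotents_le_anticentralizer[OF fin bc] many by linarith
  have "card (carrier R) = 2 * card ?C"
    by (rule half_subgroup_Un_translate(2)[OF fin additive_subgroup_anticentralizer[OF bc] half y])
  then have "card ?C \<le> card ?P"
    using card_translate_overlap[OF fin _ bc, of "ring_idempotents R"] many
    by (simp add: ring_idempotents_def)
  then have "?P = ?C"
    using PC fin by (intro card_seteq) (auto simp: anticentralizer_def)
  then show ?thesis by blast
qed

text \<open>
  Proper centralizers have only half of the elements of \<open>R\<close>, which is too few to contain all
  idempotents.
\<close>

lemma ex_idempotent_not_in_anticentralizer:
  assumes fin: "finite (carrier R)"
    and many: "3 * card (carrier R) \<le> 4 * card (ring_idempotents R)"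
    and x: "x \<in> carrier R" and y: "y \<in> carrier R" "y \<notin> anticentralizer R x"
  obtains b where "b \<in> ring_idempotents R" "b \<notin> anticentralizer R x"
proof -
  let ?C = "anticentralizer R x"
  have half: "card (carrier R) \<le> 2 * card ?C"
    using card_idempotents_le_anticentralizer[OF fin x] many by linarith
  have eq: "card (carrier R) = 2 * card ?C"
    by (rule half_subgroup_Un_translate(2)[OF fin additive_subgroup_anticentralizer[OF x] half y])
  have "\<not> ring_idempotents R \<subseteq> ?C"
  proof
    assume "ring_idempotents R \<subseteq> ?C"
    then have "card (ring_idempotents R) \<le> card ?C"
      using fin by (intro card_mono) (auto simp: anticentralizer_def)
    moreover have "0 < card (carrier R)" using fin x by (auto simp: card_gt_0_iff)
    ultimately show False using eq many by linarith
  qed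
  then show thesis using that by blast
qed

lemma ex_noncommuting_idempotents:
  assumes fin: "finite (carrier R)"
    and many: "3 * card (carrier R) \<le> 4 * card (ring_idempotents R)"
    and xy: "x \<in> carrier R" "y \<in> carrier R" "x \<otimes> y \<noteq> y \<otimes> x"
  obtains b c where "b \<in> ring_idempotents R" "c \<in> ring_idempotents R" "b \<otimes> c \<noteq> c \<otimes> b"
proof -
  have two: "\<one> \<oplus> \<one> = \<zero>" by (rule char_two_if_many_idempotents[OF fin many])
  note cent = mem_anticentralizer_iff_commute[OF two]
  obtain b where b: "b \<in> ring_idempotents R" "b \<notin> anticentralizer R x"
    using ex_idempotent_not_in_anticentralizer[OF fin many xy(1,2)] xy cent[OF xy(1)] by metis
  have bc: "b \<in> carrier R" using b by (simp add: ring_idempotents_def)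
  have "x \<notin> anticentralizer R b" using b(2) xy(1) bc cent by auto
  then obtain c where c: "c \<in> ring_idempotents R" "c \<notin> anticentralizer R b"
    using ex_idempotent_not_in_anticentralizer[OF fin many bc xy(1)] by metis
  have "c \<in> carrier R" using c by (simp add: ring_idempotents_def)
  then have "b \<otimes> c \<noteq> c \<otimes> b" using c(2) cent[OF bc] by auto
  then show thesis using that b(1) c(1) by blast
qed

text \<open>
  The centralizer of \<open>b\<close> is additively generated by the intersection of the two centralizers and
  \<open>b\<close>, and \<open>R\<close> by the centralizer of \<open>b\<close> and \<open>c\<close>. The intersection is central because the
  centralizer of \<open>b\<close> consists of idempotents: for \<open>e\<close> and \<open>f\<close> in it, idempotency of \<open>e + f\<close> gives
  \<open>e f + f e = 0\<close>.
\<close>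

lemma noncommuting_idempotents_structure:
  assumes fin: "finite (carrier R)"
    and many: "3 * card (carrier R) \<le> 4 * card (ring_idempotents R)"
    and b: "b \<in> ring_idempotents R" and c: "c \<in> ring_idempotents R"
    and bc: "b \<otimes> c \<noteq> c \<otimes> b"
  shows "ring_center R \<subseteq> ring_idempotents R"
    and "card (carrier R) = 4 * card (ring_center R)"
    and "generate_ring R (ring_center R \<union> {b, c}) = carrier R"
proof -
  let ?B = "anticentralizer R b" and ?C = "anticentralizer R c" and ?Z = "ring_center R"
  have two: "\<one> \<oplus> \<one> = \<zero>" by (rule char_two_if_many_idempotents[OF fin many])
  have car: "b \<in> carrier R" "c \<in> carrier R" using b c by (auto simp: ring_idempotents_def)
  note cent = mem_anticentralizer_iff_commute[OF two]
  have bB: "b \<in> ?B" "b \<notin> ?C" and cC: "c \<notin> ?B" using bc car cent by auto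
  have halfB: "card (carrier R) \<le> 2 * card ?B"
    using card_idempotents_le_anticentralizer[OF fin car(1)] many by linarith
  have halfC: "card (carrier R) \<le> 2 * card ?C"
    using card_idempotents_le_anticentralizer[OF fin car(2)] many by linarith
  note RB = half_subgroup_Un_translate
    [OF fin additive_subgroup_anticentralizer[OF car(1)] halfB car(2) cC]
  note RC = half_subgroup_Un_translate
    [OF fin additive_subgroup_anticentralizer[OF car(2)] halfC car(1) bB(2)]
  have idem: "?B \<subseteq> ring_idempotents R"
    by (rule centralizer_noncentral_idempotent[OF fin many b car(2) cC])
  interpret B: additive_subgroup ?B R by (rule additive_subgroup_anticentralizer[OF car(1)])
  have comm: "e \<otimes> f = f \<otimes> e" if ef: "e \<in> ?B" "f \<in> ?B" for e f
  proof -
    have ec: "e \<in> carrier R" "f \<in> carrier R" using ef B.a_subset by auto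
    have ff: "f \<otimes> f = f" using ef idem by (auto simp: ring_idempotents_def)
    have "e \<otimes> f \<oplus> f \<otimes> e \<oplus> f \<otimes> f = f"
      using ef idem by (intro idempotent_translate ec) auto
    then have "e \<otimes> f \<oplus> f \<otimes> e \<oplus> f = \<zero> \<oplus> f" using ff ec by simp
    then have "e \<otimes> f \<oplus> f \<otimes> e = \<zero>" using ec by (simp only: add.right_cancel m_closed a_closed zero_closed)
    then show ?thesis using ec add_eq_zero_iff_char_two[OF two] by simp
  qed
  have Z: "?Z = ?B \<inter> ?C"
  proof (intro equalityI subsetI IntI)
    fix z assume "z \<in> ?Z"
    then show "z \<in> ?B" "z \<in> ?C" using car cent by (auto simp: ring_center_def)
  next
    fix z assume "z \<in> ?B \<inter> ?C"
    then have zB: "z \<in> ?B" and z: "z \<in> carrier R" "z \<otimes> c = c \<otimes> z" using car cent by auto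
    have "z \<otimes> r = r \<otimes> z" if "r \<in> carrier R" for r
    proof -
      from that RB(1) consider "r \<in> ?B" | h where "h \<in> ?B" "r = c \<oplus> h" by blast
      then show ?thesis
      proof cases
        case 2
        then have "h \<in> carrier R" "z \<otimes> h = h \<otimes> z" using comm[OF zB] B.a_subset by auto
        then show ?thesis using 2 z car by (simp add: l_distr r_distr)
      qed (rule comm[OF zB])
    qed
    then show "z \<in> ?Z" using z by (simp add: ring_center_def)
  qed
  then show "?Z \<subseteq> ring_idempotents R" using idem by blast
  have BZ: "?B = ?Z \<union> (\<lambda>z. b \<oplus> z) ` ?Z"
  proof (intro equalityI subsetI)
    fix e assume e: "e \<in> ?B"
    then have ec: "e \<in> carrier R" using B.a_subset by auto
    then consider "e \<in> ?C" | h where "h \<in> ?C" "e = b \<oplus> h" using RC(1) by blast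
    then show "e \<in> ?Z \<union> (\<lambda>z. b \<oplus> z) ` ?Z"
    proof cases
      case 1
      then show ?thesis using e Z by simp
    next
      case 2
      then have hc: "h \<in> carrier R" using cent[OF car(2)] by auto
      have "b \<oplus> e = h"
        using 2 hc car add_self_char_two[OF two car(1)] by (simp flip: a_assoc)
      then have "h \<in> ?B" using e bB(1) by auto
      then show ?thesis using 2 Z by auto
    qed
  qed (use bB(1) Z in auto)
  have Zsub: "additive_subgroup ?Z R"
    using subring.axioms(1)[OF subring_ring_center] by (rule additive_subgroup.intro)
  have "b \<notin> ?Z" using bB Z by simp
  then have "card ?B = 2 * card ?Z"
    using card_subgroup_Un_translate[OF fin Zsub car(1)] BZ by simp
  then show "card (carrier R) = 4 * card ?Z" using RB(2) by simp
  have gen: "?Z \<union> {b, c} \<subseteq> generate_ring R (?Z \<union> {b, c})"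
    by (auto intro: generate_ring.incl)
  have "?B \<subseteq> generate_ring R (?Z \<union> {b, c})"
    using gen by (subst BZ) (auto intro: generate_ring.eng_add)
  then have "carrier R \<subseteq> generate_ring R (?Z \<union> {b, c})"
    using gen by (subst RB(1)) (auto intro!: generate_ring.eng_add)
  moreover have "?Z \<union> {b, c} \<subseteq> carrier R" using car by (auto simp: ring_center_def)
  ultimately show "generate_ring R (?Z \<union> {b, c}) = carrier R"
    using generate_ring_incl by blast
qed

end

section \<open>The bound and its equality case\<close>

theorem theorem3p1:
  fixes R :: "('a, 'm) ring_scheme" (structure)
  assumes "ring R"
    and "finite (carrier R)"
    and "\<exists>x \<in> carrier R. \<exists>y \<in> carrier R. x \<otimes> y \<noteq> y \<otimes> x"
  shows "real (card (ring_idempotents R)) \<le> 3 * real (card (carrier R)) / 4 \<and>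
    (real (card (ring_idempotents R)) = 3 * real (card (carrier R)) / 4 \<longrightarrow>
      (\<exists>C b c.
        subring C R \<and> boolean_ring (R\<lparr>carrier := C\<rparr>) \<and> C \<subseteq> ring_center R \<and>
        b \<in> ring_idempotents R \<and> c \<in> ring_idempotents R \<and> b \<otimes> c \<noteq> c \<otimes> b \<and>
        generate_ring R (C \<union> {b, c}) = carrier R \<and>
        real (card C) = real (card (carrier R)) / 4))"
proof -
  interpret ring R by (rule assms(1))
  note fin = assms(2)
  obtain x y where xy: "x \<in> carrier R" "y \<in> carrier R" "x \<otimes> y \<noteq> y \<otimes> x"
    using assms(3) by blast
  have le: "4 * card (ring_idempotents R) \<le> 3 * card (carrier R)"
    using commute_if_card_idempotents_gt[OF fin _ xy(1,2)] xy(3) by (meson not_le)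
  show ?thesis
  proof (intro conjI impI)
    show "real (card (ring_idempotents R)) \<le> 3 * real (card (carrier R)) / 4"
      using le by linarith
  next
    assume "real (card (ring_idempotents R)) = 3 * real (card (carrier R)) / 4"
    then have many: "3 * card (carrier R) \<le> 4 * card (ring_idempotents R)" by linarith
    obtain b c where bc: "b \<in> ring_idempotents R" "c \<in> ring_idempotents R" "b \<otimes> c \<noteq> c \<otimes> b"
      using ex_noncommuting_idempotents[OF fin many xy] .
    note S = noncommuting_idempotents_structure[OF fin many bc]
    have "boolean_ring (R\<lparr>carrier := ring_center R\<rparr>)"
      by (rule boolean_ring_subring[OF subring_ring_center S(1)])
    moreover have "real (card (ring_center R)) = real (card (carrier R)) / 4"
      using S(2) by simp
    ultimately show "\<exists>C b c.
        subring C R \<and> boolean_ring (R\<lparr>carrier := C\<rparr>) \<and> C \<subseteq> ring_center R \<and>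
        b \<in> ring_idempotents R \<and> c \<in> ring_idempotents R \<and> b \<otimes> c \<noteq> c \<otimes> b \<and>
        generate_ring R (C \<union> {b, c}) = carrier R \<and>
        real (card C) = real (card (carrier R)) / 4"
      using subring_ring_center bc S(3) by blast
  qed
qed

end
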